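(* Let $\mathbb{F}=\mathbb{R}$ or $\mathbb{F}=\mathbb{C}$. Let $A\in\mathbb{F}^{m\times n}$ be a matrix and let $\hat A_{\mathrm{in}}\in\mathbb{F}^{m\times n}$ be an approximation of it (an arbitrary matrix of the same size). For any rank parameter $r$ (a natural number) and any best rank-$r$ approximation $[\![\hat A_{\mathrm{in}}]\!]_r$ of $\hat A_{\mathrm{in}}$ with respect to the Frobenius norm, $$ \|A-[\![\hat A_{\mathrm{in}}]\!]_r\|_{\mathrm F}\;\le\;\tau_{r+1}(A)+2\,\|A-\hat A_{\mathrm{in}}\|_{\mathrm F}. $$
   Context: $\|\cdot\|_{\mathrm F}$ is the Frobenius norm. $[\![M]\!]_r$ denotes an optimal rank-$r$ approximation of $M$ in Frobenius norm, i.e. a minimizer of $\|M-B\|_{\mathrm F}$ over matrices $B$ of rank at most $r$ (not necessarily unique). The tail energy is $\tau_j(A)=\big(\min_{\operatorname{rank}(B)<j}\|A-B\|_{\mathrm F}^2\big)^{1/2}=\big(\sum_{i\ge j}\sigma_i^2(A)\big)^{1/2}$, where $\sigma_i(A)$ is the $i$th largest singular value of $A$ (zero for $i>\min\{m,n\}$). *)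

theory Defs
  imports "HOL-Analysis.Analysis"
begin

text \<open>
  An \<open>m\<close> by \<open>n\<close> matrix over \<open>'a\<close> has type \<open>'a^'n^'m\<close>, with \<open>CARD('m) = m\<close> and \<open>CARD('n) = n\<close>.
  The class \<open>real_normed_field\<close> makes the definitions available for both \<open>real\<close> and \<open>complex\<close>;
  \<open>rank\<close> is the library's rank, i.e. the dimension over \<open>'a\<close> itself of the row space.
\<close>

definition frobenius_norm :: "'a::real_normed_field^'n^'m \<Rightarrow> real" where
  "frobenius_norm A = sqrt (\<Sum>i\<in>UNIV. \<Sum>j\<in>UNIV. (norm (A $ i $ j))\<^sup>2)"

text \<open>Best approximations need not be unique, so they are given by a predicate.\<close>

definition best_rank_approx :: "nat \<Rightarrow> 'a::real_normed_field^'n^'m \<Rightarrow> 'a^'n^'m \<Rightarrow> bool" where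
  "best_rank_approx r M B \<longleftrightarrow>
     rank B \<le> r \<and> (\<forall>C. rank C \<le> r \<longrightarrow> frobenius_norm (M - B) \<le> frobenius_norm (M - C))"

text \<open>
  The infimum is a minimum for every \<open>j \<ge> 1\<close>: see \<open>tail_energy_attained\<close> below.
  (For \<open>j = 0\<close> no matrix satisfies the constraint and the value carries no meaning.)
\<close>

definition tail_energy :: "nat \<Rightarrow> 'a::real_normed_field^'n^'m \<Rightarrow> real" where
  "tail_energy j A = sqrt (INF B \<in> {B. rank B < j}. (frobenius_norm (A - B))\<^sup>2)"

lemma frobenius_norm_eq_norm: "frobenius_norm A = norm A"
  by (simp add: frobenius_norm_def norm_vec_def L2_set_def sum_nonneg)

lemma rank_zero: "rank (0 :: 'a::field^'n^'m) = 0"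
proof -
  have "vec.span (rows (0 :: 'a^'n^'m)) \<subseteq> {0}"
    by (intro vec.span_minimal) (auto simp: rows_def row_def vec_eq_iff)
  then have "vec.dim (rows (0 :: 'a^'n^'m)) \<le> vec.dim ({} :: ('a^'n) set)"
    by (intro vec.span_mono vec.dim_mono) (use vec.span_superset in fastforce)
  then show ?thesis
    by (simp add: row_rank_def_gen)
qed

lemma vector_matrix_mult_sum_rows:
  fixes C :: "'a::field^'n^'m"
  shows "x v* C = (\<Sum>i\<in>UNIV. x $ i *s row i C)"
  by (simp add: vec_eq_iff vector_matrix_mult_def row_def mult.commute)

lemma rank_less_imp_rows_dependent:
  fixes C :: "'a::field^'n^'m"
  assumes "rank C < card I"
  shows "\<exists>x. x \<noteq> 0 \<and> (\<forall>i. i \<notin> I \<longrightarrow> x $ i = 0) \<and> x v* C = 0"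
proof (cases "inj_on (\<lambda>i. row i C) I")
  case True
  let ?S = "(\<lambda>i. row i C) ` I"
  have "vec.dim (rows C) < card ?S"
    using assms True by (simp add: row_rank_def_gen card_image)
  then have "vec.dependent ?S"
    using vec.independent_card_le_dim[of ?S "rows C"] by (auto simp: rows_def)
  then obtain u v where u: "v \<in> ?S" "u v \<noteq> 0" "(\<Sum>v\<in>?S. u v *s v) = 0"
    using vec.dependent_finite[of ?S] by auto
  define x where "x = (\<chi> i. if i \<in> I then u (row i C) else 0)"
  have "x v* C = (\<Sum>i\<in>I. x $ i *s row i C)"
    unfolding vector_matrix_mult_sum_rows by (rule sum.mono_neutral_right) (auto simp: x_def)
  also have "\<dots> = (\<Sum>i\<in>I. u (row i C) *s row i C)"
    by (rule sum.cong) (auto simp: x_def)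
  also have "\<dots> = 0"
    using u(3) by (simp add: sum.reindex[OF True])
  finally have "x v* C = 0" .
  moreover have "x \<noteq> 0"
    using u(1,2) by (auto simp: x_def vec_eq_iff)
  ultimately show ?thesis
    by (intro exI[of _ x]) (auto simp: x_def)
next
  case False
  then obtain i j where ij: "i \<in> I" "j \<in> I" "i \<noteq> j" "row i C = row j C"
    by (auto simp: inj_on_def)
  define x :: "'a^'m" where "x = axis i 1 - axis j 1"
  have "x v* C = axis i 1 v* C - axis j 1 v* C"
    by (simp add: x_def vec_eq_iff vector_matrix_mult_def algebra_simps sum_subtractf)
  also have "\<dots> = row i C - row j C"
    by (simp add: vec_eq_iff vector_matrix_mult_def row_def axis_def if_distrib if_distribR cong: if_cong)
  finally have "x v* C = 0"
    using ij by simp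
  moreover have "x $ i \<noteq> 0"
    using ij by (simp add: x_def axis_def)
  then have "x \<noteq> 0"
    by auto
  ultimately show ?thesis
    using ij by (intro exI[of _ x]) (auto simp: x_def axis_def)
qed

lemma rank_rows_independent:
  fixes C :: "'a::field^'n^'m"
  obtains I where "card I = rank C"
    "\<And>x. (\<And>i. i \<notin> I \<Longrightarrow> x $ i = 0) \<Longrightarrow> x v* C = 0 \<Longrightarrow> x = 0"
proof -
  obtain S where S: "S \<subseteq> rows C" "vec.independent S" "card S = vec.dim (rows C)"
    using vec.basis_exists[of "rows C"] by metis
  have "rows C = range (\<lambda>i. row i C)"
    by (auto simp: rows_def)
  then obtain I where I: "inj_on (\<lambda>i. row i C) I" "S = (\<lambda>i. row i C) ` I"
    using S(1) by (metis subset_image_inj)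
  show thesis
  proof
    show "card I = rank C"
      using S(3) I by (simp add: row_rank_def_gen card_image)
    fix x :: "'a^'m"
    assume x: "\<And>i. i \<notin> I \<Longrightarrow> x $ i = 0" "x v* C = 0"
    define u where "u v = x $ (inv_into I (\<lambda>i. row i C) v)" for v
    have "(\<Sum>v\<in>S. u v *s v) = (\<Sum>i\<in>I. x $ i *s row i C)"
      using inv_into_f_f[OF I(1)] by (simp add: I(2) u_def sum.reindex[OF I(1)])
    also have "\<dots> = x v* C"
      unfolding vector_matrix_mult_sum_rows by (rule sum.mono_neutral_left) (auto simp: x)
    finally have "(\<Sum>v\<in>S. u v *s v) = 0"
      using x by simp
    then have "\<forall>v\<in>S. u v = 0"
      using S(2) vec.dependent_finite[of S] I(2) by auto
    then have "x $ i = 0" if "i \<in> I" for i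
      using that inv_into_f_f[OF I(1)] by (auto simp: I(2) u_def)
    then show "x = 0"
      using x(1) by (metis vec_eq_iff zero_index)
  qed
qed

lemma closed_rank_less:
  "closed {B :: 'a::{real_normed_field,euclidean_space}^'n^'m. rank B < j}"
  unfolding closed_sequential_limits
proof clarify
  fix X and B :: "'a^'n^'m"
  assume X: "\<forall>k. X k \<in> {B. rank B < j}" "X \<longlonglongrightarrow> B"
  show "rank B < j"
  proof (rule ccontr)
    assume less: "\<not> rank B < j"
    obtain I where I: "card I = rank B"
      "\<And>x. (\<And>i. i \<notin> I \<Longrightarrow> x $ i = 0) \<Longrightarrow> x v* B = 0 \<Longrightarrow> x = 0"
      using rank_rows_independent by metis
    define K where "K = sphere (0 :: 'a^'m) 1 \<inter> (\<Inter>i\<in>-I. {x. x $ i = 0})"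
    have "compact K"
      unfolding K_def
      by (intro compact_Int_closed closed_INT ballI closed_Collect_eq continuous_intros) auto
    have "\<exists>x\<in>K. x v* X k = 0" for k
    proof -
      have "rank (X k) < card I"
        using X(1) less I(1) by (metis (mono_tags) mem_Collect_eq not_le order_less_le_trans)
      then obtain x where x: "x \<noteq> 0" "\<forall>i. i \<notin> I \<longrightarrow> x $ i = 0" "x v* X k = 0"
        using rank_less_imp_rows_dependent by blast
      define y where "y = x /\<^sub>R norm x"
      have "y v* X k = (x v* X k) /\<^sub>R norm x"
        by (simp add: y_def vec_eq_iff vector_matrix_mult_def scaleR_sum_right)
      moreover have "y \<in> K"
        using x by (simp add: K_def y_def)
      ultimately show ?thesis
        using x by auto
    qed
    then obtain x where x: "\<And>k. x k \<in> K" "\<And>k. x k v* X k = 0"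
      by metis
    then obtain l r where l: "l \<in> K" "strict_mono r" "(x \<circ> r) \<longlonglongrightarrow> l"
      using \<open>compact K\<close> unfolding compact_def by metis
    have "(X \<circ> r) \<longlonglongrightarrow> B"
      using X(2) l(2) by (rule LIMSEQ_subseq_LIMSEQ)
    with l(3) have "(\<lambda>k. (x \<circ> r) k v* (X \<circ> r) k) \<longlonglongrightarrow> l v* B"
      unfolding vector_matrix_mult_def
      by (intro tendsto_intros)
    moreover have "(\<lambda>k. (x \<circ> r) k v* (X \<circ> r) k) = (\<lambda>k. 0)"
      using x(2) by (simp add: fun_eq_iff)
    ultimately have "l v* B = 0"
      by (simp add: LIMSEQ_const_iff)
    then have "l = 0"
      using l(1) by (intro I(2)) (auto simp: K_def)
    then show False
      using l(1) by (simp add: K_def)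
  qed
qed

lemma tail_energy_attained:
  fixes A :: "'a::{real_normed_field,euclidean_space}^'n^'m"
  assumes "1 \<le> j"
  obtains B where "rank B < j" "tail_energy j A = frobenius_norm (A - B)"
    "\<And>C. rank C < j \<Longrightarrow> frobenius_norm (A - B) \<le> frobenius_norm (A - C)"
proof -
  have "{B :: 'a^'n^'m. rank B < j} \<noteq> {}"
    using assms rank_zero by (metis (mono_tags) empty_Collect_eq less_le_trans zero_less_one)
  then obtain B where B: "rank B < j" "\<And>C. rank C < j \<Longrightarrow> dist A B \<le> dist A C"
    using distance_attains_inf[OF closed_rank_less, of j A] by auto
  have min: "frobenius_norm (A - B) \<le> frobenius_norm (A - C)" if "rank C < j" for C
    using B(2)[OF that] by (simp add: frobenius_norm_eq_norm dist_norm)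
  have "(INF B \<in> {B. rank B < j}. (frobenius_norm (A - B))\<^sup>2) = (frobenius_norm (A - B))\<^sup>2"
    using B(1) min
    by (intro cInf_eq_minimum) (auto intro!: power_mono simp: frobenius_norm_eq_norm)
  then have "tail_energy j A = frobenius_norm (A - B)"
    by (simp add: tail_energy_def frobenius_norm_eq_norm)
  with B(1) min show thesis
    using that by blast
qed

end

theory Submission
  imports Defs
begin

text \<open>Let \<open>C\<close> be a best rank-\<open>r\<close> approximation of \<open>A\<close>,
  given by \<open>tail_energy_attained\<close>. Since \<open>B\<close> is at least as close to
  \<open>M\<close> as \<open>C\<close> is, the triangle inequality can go from \<open>A\<close> to
  \<open>B\<close> via \<open>M\<close>, swap \<open>B\<close> for \<open>C\<close>, and return from
  \<open>M\<close> to \<open>C\<close> via \<open>A\<close>. The distance from \<open>A\<close> to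
  \<open>M\<close> is thus paid twice.\<close>

lemma frobenius_norm_diff_best_rank_approx_le:
  fixes A :: "'a::{real_normed_field,euclidean_space}^'n^'m"
  assumes "best_rank_approx r M B"
  shows "frobenius_norm (A - B) \<le> tail_energy (r + 1) A + 2 * frobenius_norm (A - M)"
proof -
  \<comment> \<open>The rank bound in \<open>tail_energy\<close> is strict, so index
    \<open>r + 1\<close> allows exactly rank at most \<open>r\<close>, and \<open>C\<close> competes
    with \<open>B\<close>.\<close>
  obtain C where C: "rank C < r + 1" "tail_energy (r + 1) A = frobenius_norm (A - C)"
    using tail_energy_attained[of "r + 1" A] by auto
  have "norm (A - B) \<le> norm (A - M) + norm (M - B)"
    using norm_triangle_ineq[of "A - M" "M - B"] by simp
  also have "norm (M - B) \<le> norm (M - C)"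
    using assms C(1) by (simp add: best_rank_approx_def frobenius_norm_eq_norm)
  also have "norm (M - C) \<le> norm (A - M) + norm (A - C)"
    using norm_triangle_ineq[of "M - A" "A - C"] by (simp add: norm_minus_commute)
  finally show ?thesis
    using C(2) by (simp add: frobenius_norm_eq_norm)
qed

theorem proposition6p1:
  fixes r :: nat
  shows "(\<forall>(A :: real^'n^'m) A\<^sub>i\<^sub>n B. best_rank_approx r A\<^sub>i\<^sub>n B \<longrightarrow>
            frobenius_norm (A - B) \<le> tail_energy (r + 1) A + 2 * frobenius_norm (A - A\<^sub>i\<^sub>n)) \<and>
         (\<forall>(A :: complex^'n^'m) A\<^sub>i\<^sub>n B. best_rank_approx r A\<^sub>i\<^sub>n B \<longrightarrow>
            frobenius_norm (A - B) \<le> tail_energy (r + 1) A + 2 * frobenius_norm (A - A\<^sub>i\<^sub>n))"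
  \<comment> \<open>Both \<open>real\<close> and \<open>complex\<close> belong to the sort of the
    lemma.\<close>
  by (intro conjI allI impI frobenius_norm_diff_best_rank_approx_le)

end
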